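(* Let $k$ be a field of characteristic $0$ and let $\lambda\in k$. Suppose that $(T,\prec,\succ,\circ)$ is a dendriform trialgebra over $k$ with a linear basis $X=\{x_n\mid n\in I\}$, where $I$ is a well ordered set. Let $x_i\prec x_j=[x_i,x_j]$, $x_i\succ x_j=[[x_i,x_j]]$, $x_i\circ x_j=\langle x_i,x_j\rangle$, where $[x_i,x_j]$, $[[x_i,x_j]]$ and $\langle x_i,x_j\rangle$ are linear combinations of elements $x_n\in X$, regarded also as elements of the free nonunitary Rota-Baxter algebra $RB(X)$ of weight $\lambda$. Let $S\subset RB(X)$ be the set consisting of, for $i,j\in I$, $$x_iP(x_j)-[x_i,x_j],\qquad P(x_i)x_j-[[x_i,x_j]],\qquad \lambda x_ix_j-\langle x_i,x_j\rangle.$$ Then in $RB(X)$ all intersection compositions and inclusion compositions in $S$ are trivial.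
   Context: Dendriform trialgebra: a $k$-module $T$ with three binary operations $\prec,\succ,\circ$ such that, with $x*y=x\prec y+x\succ y+x\circ y$, for all $x,y,z\in T$: $(x\prec y)\prec z=x\prec(y*z)$; $(x\succ y)\prec z=x\succ(y\prec z)$; $(x*y)\succ z=x\succ(y\succ z)$; $(x\succ y)\circ z=x\succ(y\circ z)$; $(x\prec y)\circ z=x\circ(y\succ z)$; $(x\circ y)\prec z=x\circ(y\prec z)$; $(x\circ y)\circ z=x\circ(y\circ z)$. Rota-Baxter algebras. A Rota-Baxter algebra of weight $\lambda\in k$ is an associative $k$-algebra $A$ (without unity) with a $k$-linear $P:A\to A$ satisfying $P(x)P(y)=P(P(x)y)+P(xP(y))+\lambda P(xy)$. Free Rota-Baxter algebra $RB(X)$. $S(X)$ is the free semigroup (no identity) on $X$. Put $\Phi_0=S(X)$, and let $\Phi_n$ be the set of all nonempty finite formal words that alternate between factors from $S(X)$ and factors of the form $P(z)$, $z\in\Phi_{n-1}$ (starting and ending with either type; so no two factors $P(z_1)P(z_2)$ are adjacent). $\Phi(X)=\bigcup_{n\ge0}\Phi_n$. An element of $X\cup P(\Phi(X))$ is called prime; every $u\in\Phi(X)$ is uniquely $u=u_1\cdots u_n$ with $u_i$ prime and no two consecutive $u_i$ both in $P(\Phi(X))$. $RB(X)$ is the $k$-vector space with basis $\Phi(X)$, with $P$ the linear extension of $u\mapsto P(u)$ and with bilinear product defined recursively: for primes $u,v$, $u\cdot v=P(P(u')\cdot v')+P(u'\cdot P(v'))+\lambda P(u'\cdot v')$ if $u=P(u')$,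 $v=P(v')$, and $u\cdot v=uv$ (concatenation) otherwise; for $u=u_1\cdots u_s$, $v=v_1\cdots v_l$ (prime factorizations), $u\cdot v=u_1\cdots u_{s-1}(u_s\cdot v_1)v_2\cdots v_l$. Ordering. $X$ is ordered by its index set. For $T'\subseteq X\cup\{P\}$, $\deg_{T'}(u)$ is the number of occurrences in $u$ of symbols of $T'$; $Deg(u)=(\deg_{\{P\}\cup X}(u),\deg_{\{P\}}(u))$, ordered lexicographically. For $u,v\in\Phi(X)$: if $Deg(u)>Deg(v)$ then $u>v$. If $Deg(u)=Deg(v)$: for $u,v\in X$ use the order of $X$; if $u=P(u')$, $v=P(v')$ then $u>v$ iff $u'>v'$; otherwise, with prime factorizations $u=u_1\cdots u_l$, $v=v_1\cdots v_s$ ($l>1$ or $s>1$), $u>v$ iff $(u_1,\dots,u_l)>(v_1,\dots,v_s)$ lexicographically. This is a well ordering. For $0\ne f\in RB(X)$, $\bar f\in\Phi(X)$ denotes its largest basis word (leading term); $f$ is monic if the coefficient of $\bar f$ is $1$. $s$-words. $\star\notin X$ is a new symbol; $\Phi^\star(X)$ is the set of words in $\Phi(X\cup\{\star\})$ with exactly one occurrence of $\star$. For $u\in\Phi^\star(X)$ and $s\in RB(X)$, $u|_s\in RB(X)$ is the result of replacing $\star$ by $s$; it is called an $s$-word. It is a normal $s$-word if $\overline{u|_s}=u|_{\bar s}$. Compositions (defined for monic $f,g$). Intersection composition: if $w=\bar f a=b\bar g$ with $a,b\in\Phi(X)$, $fa$ a normal $f$-word, $bg$ a normal $g$-word, and $\deg_{\{P\}\cup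 X}(w)<\deg_{\{P\}\cup X}(\bar f)+\deg_{\{P\}\cup X}(\bar g)$, then $(f,g)_w=f\cdot a-b\cdot g$. Inclusion composition: if $w=\bar f=u|_{\bar g}$ with $u\in\Phi^\star(X)$, then $(f,g)_w=f-u|_g$. A composition $(f,g)_w$ of elements $f,g\in S$ is trivial (modulo $(S,w)$) if $(f,g)_w=\sum_i\alpha_iu_i|_{s_i}$ (finite sum) with $\alpha_i\in k$, $s_i\in S$, $u_i|_{s_i}$ normal $s_i$-words and $u_i|_{\overline{s_i}}<w$.
   Formalization: The formal theorem assumes λ ≠ 0 (and divides the elements of S by their leading coefficients); for λ = 0 the claim fails, e.g. T = kx with x≺x = x, x≻x = x∘x = 0, where w = xP(x)x gives the nontrivial composition −xx. *)

theory Defs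
  imports Complex_Main "HOL-Library.Poly_Mapping"
begin

section \<open>Dendriform trialgebras\<close>

locale dendriform_trialgebra = vector_space scale
  for scale :: "'k::field \<Rightarrow> 't::ab_group_add \<Rightarrow> 't" +
  fixes prec succ circ :: "'t \<Rightarrow> 't \<Rightarrow> 't"
  assumes linear_prec_left: "\<And>y. Vector_Spaces.linear scale scale (\<lambda>x. prec x y)"
    and linear_prec_right: "\<And>x. Vector_Spaces.linear scale scale (\<lambda>y. prec x y)"
    and linear_succ_left: "\<And>y. Vector_Spaces.linear scale scale (\<lambda>x. succ x y)"
    and linear_succ_right: "\<And>x. Vector_Spaces.linear scale scale (\<lambda>y. succ x y)"
    and linear_circ_left: "\<And>y. Vector_Spaces.linear scale scale (\<lambda>x. circ x y)"
    and linear_circ_right: "\<And>x. Vector_Spaces.linear scale scale (\<lambda>y. circ x y)"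
    and prec_prec: "\<And>x y z. prec (prec x y) z = prec x (prec y z + succ y z + circ y z)"
    and succ_prec: "\<And>x y z. prec (succ x y) z = succ x (prec y z)"
    and star_succ: "\<And>x y z. succ (prec x y + succ x y + circ x y) z = succ x (succ y z)"
    and succ_circ: "\<And>x y z. circ (succ x y) z = succ x (circ y z)"
    and prec_circ: "\<And>x y z. circ (prec x y) z = circ x (succ y z)"
    and circ_prec: "\<And>x y z. prec (circ x y) z = circ x (prec y z)"
    and circ_circ: "\<And>x y z. circ (circ x y) z = circ x (circ y z)"

text \<open>A linear basis of the whole space, indexed without repetition.\<close>

definition indexed_basis :: "('k::field \<Rightarrow> 't::ab_group_add \<Rightarrow> 't) \<Rightarrow> ('i \<Rightarrow> 't) \<Rightarrow> bool" where
  "indexed_basis scale x \<longleftrightarrow>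
     inj x \<and> \<not> module.dependent scale (range x) \<and> module.span scale (range x) = UNIV"


section \<open>Rota--Baxter words\<close>

text \<open>A word is the list of its prime factors; \<open>PP u\<close> is the formal symbol $P(u)$.
  The alternating words $\Phi(X)$ are singled out by \<open>Phi\<close> below.\<close>

datatype 'a prime = Gen 'a | is_PP: PP "'a prime list"

type_synonym 'a word = "'a prime list"

text \<open>A product of factors from $S(X)$ and factors $P(z)$ is alternating, as a word in prime
  factors, iff no two factors $P(z_1)$, $P(z_2)$ are adjacent.\<close>

fun Phi_level :: "nat \<Rightarrow> 'a word set" where
  "Phi_level 0 = {u. u \<noteq> [] \<and> set u \<subseteq> range Gen}"
| "Phi_level (Suc n) =
     {u. u \<noteq> [] \<and> set u \<subseteq> range Gen \<union> PP ` Phi_level n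
       \<and> successively (\<lambda>p q. \<not> (is_PP p \<and> is_PP q)) u}"

definition Phi :: "'a word set" where
  "Phi = (\<Union>n. Phi_level n)"

text \<open>Number of occurrences of symbols from \<open>T\<close>, where the symbol $P$ is counted iff \<open>c\<close> holds.\<close>

primrec deg_prime :: "'a set \<Rightarrow> bool \<Rightarrow> 'a prime \<Rightarrow> nat" where
  "deg_prime T c (Gen x) = (if x \<in> T then 1 else 0)"
| "deg_prime T c (PP u) = (if c then 1 else 0) + sum_list (map (deg_prime T c) u)"

definition deg_in :: "'a set \<Rightarrow> bool \<Rightarrow> 'a word \<Rightarrow> nat" where
  "deg_in T c u = sum_list (map (deg_prime T c) u)"

definition degPX :: "'a word \<Rightarrow> nat" where
  "degPX u = deg_in UNIV True u"

definition Deg :: "'a word \<Rightarrow> nat \<times> nat" where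
  "Deg u = (degPX u, deg_in {} True u)"

text \<open>The ordering $u < v$ of $\Phi(X)$.  In the last rule a proper prefix need not be considered:
  it has a strictly smaller \<open>Deg\<close>.\<close>

inductive word_less :: "'a::linorder word \<Rightarrow> 'a word \<Rightarrow> bool" where
  deg: "(Deg u, Deg v) \<in> less_than <*lex*> less_than \<Longrightarrow> word_less u v"
| gen: "x < y \<Longrightarrow> word_less [Gen x] [Gen y]"
| PP: "Deg [PP u] = Deg [PP v] \<Longrightarrow> word_less u v \<Longrightarrow> word_less [PP u] [PP v]"
| lex: "Deg u = Deg v \<Longrightarrow> length u > 1 \<or> length v > 1 \<Longrightarrow>
        u = c @ p # us \<Longrightarrow> v = c @ q # vs \<Longrightarrow> word_less [p] [q] \<Longrightarrow> word_less u v"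


section \<open>The free nonunitary Rota--Baxter algebra of weight \<open>lam\<close>\<close>

text \<open>Elements are finitely supported functions on words; \<open>RB(X)\<close> consists of those supported
  on \<^const>\<open>Phi\<close>.  (The operations below are only meaningful there.)  Note that the product of
  \<^type>\<open>poly_mapping\<close> is not used: the Rota--Baxter product is \<open>rb_mult\<close>.\<close>

type_synonym ('a, 'k) rb = "'a word \<Rightarrow>\<^sub>0 'k"

definition RB :: "('a, 'k::field) rb set" where
  "RB = {f. Poly_Mapping.keys f \<subseteq> Phi}"

definition of_word :: "'a word \<Rightarrow> ('a, 'k::field) rb" where
  "of_word u = Poly_Mapping.single u 1"

definition rb_scale :: "'k::field \<Rightarrow> ('a, 'k) rb \<Rightarrow> ('a, 'k) rb" where
  "rb_scale c f = Poly_Mapping.map ((*) c) f"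

definition lin_ext :: "('a word \<Rightarrow> ('b, 'k) rb) \<Rightarrow> ('a, 'k::field) rb \<Rightarrow> ('b, 'k) rb" where
  "lin_ext h f = (\<Sum>u\<in>Poly_Mapping.keys f. rb_scale (Poly_Mapping.lookup f u) (h u))"

definition rb_P :: "('a, 'k::field) rb \<Rightarrow> ('a, 'k) rb" where
  "rb_P f = lin_ext (\<lambda>u. of_word [PP u]) f"

lemma size_prime_less_size_list: "p \<in> set u \<Longrightarrow> size p < size_list size u"
  for p :: "'a prime"
  by (induction u) auto

function (sequential)
  prime_mult :: "'k::field \<Rightarrow> 'a prime \<Rightarrow> 'a prime \<Rightarrow> ('a, 'k) rb" and
  word_mult :: "'k::field \<Rightarrow> 'a word \<Rightarrow> 'a word \<Rightarrow> ('a, 'k) rb"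
where
  "prime_mult lam (PP u) (PP v) =
     rb_P (word_mult lam [PP u] v) + rb_P (word_mult lam u [PP v])
       + rb_scale lam (rb_P (word_mult lam u v))"
| "prime_mult lam p q = of_word [p, q]"
| "word_mult lam u v =
     (if u = [] \<or> v = [] then 0
      else lin_ext (\<lambda>z. of_word (butlast u @ z @ tl v)) (prime_mult lam (last u) (hd v)))"
  by pat_completeness auto
termination
proof (relation "measure (\<lambda>a. case a of
      Inl (_, p, q) \<Rightarrow> 2 * (size p + size q) + 1
    | Inr (_, u, v) \<Rightarrow> 2 * (size_list size u + size_list size v))", goal_cases)
  case (5 lam u v)
  then have "size (last u) < size_list size u" "size (hd v) < size_list size v"
    by (simp_all add: size_prime_less_size_list)
  then show ?case by simp
qed auto

definition rb_mult :: "'k::field \<Rightarrow> ('a, 'k) rb \<Rightarrow> ('a, 'k) rb \<Rightarrow> ('a, 'k) rb" where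
  "rb_mult lam f g = lin_ext (\<lambda>u. lin_ext (\<lambda>v. word_mult lam u v) g) f"


section \<open>Leading terms and \<open>s\<close>-words\<close>

definition lead :: "('a::linorder, 'k::field) rb \<Rightarrow> 'a word" where
  "lead f = (THE u. u \<in> Poly_Mapping.keys f \<and> (\<forall>v\<in>Poly_Mapping.keys f. v \<noteq> u \<longrightarrow> word_less v u))"

definition monic :: "('a::linorder, 'k::field) rb \<Rightarrow> bool" where
  "monic f \<longleftrightarrow> f \<noteq> 0 \<and> Poly_Mapping.lookup f (lead f) = 1"

definition monicize :: "('a::linorder, 'k::field) rb \<Rightarrow> ('a, 'k) rb" where
  "monicize f = rb_scale (inverse (Poly_Mapping.lookup f (lead f))) f"

text \<open>In \<open>'a option\<close>, \<open>None\<close> is the new symbol $\star$ and \<open>Some x\<close> is the old generator \<open>x\<close>.\<close>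

definition Phi_star :: "'a option word set" where
  "Phi_star = {u \<in> Phi. deg_in {None} False u = 1}"

fun subst_prime :: "'k::field \<Rightarrow> ('a, 'k) rb \<Rightarrow> 'a option prime \<Rightarrow> ('a, 'k) rb"
  and subst_word :: "'k::field \<Rightarrow> ('a, 'k) rb \<Rightarrow> 'a option word \<Rightarrow> ('a, 'k) rb" where
  "subst_prime lam s (Gen None) = s"
| "subst_prime lam s (Gen (Some x)) = of_word [Gen x]"
| "subst_prime lam s (PP u) = rb_P (subst_word lam s u)"
| "subst_word lam s [] = 0"
| "subst_word lam s [p] = subst_prime lam s p"
| "subst_word lam s (p # q # u) = rb_mult lam (subst_prime lam s p) (subst_word lam s (q # u))"

text \<open>For $u \in \Phi^\star(X)$ the element $u|_{\bar s}$ of \<open>RB(X)\<close> need not be a basis word.\<close>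

definition normal_sword ::
    "'k::field \<Rightarrow> 'a::linorder option word \<Rightarrow> ('a, 'k) rb \<Rightarrow> bool" where
  "normal_sword lam u s \<longleftrightarrow>
     u \<in> Phi_star \<and> s \<noteq> 0 \<and> subst_word lam s u \<noteq> 0
     \<and> of_word (lead (subst_word lam s u)) = subst_word lam (of_word (lead s)) u"


section \<open>Compositions\<close>

definition embed_word :: "'a word \<Rightarrow> 'a option word" where
  "embed_word u = map (map_prime Some) u"

text \<open>\<open>h\<close> is an intersection composition $(f,g)_w$; that $fa$ is a normal \<open>f\<close>-word means that
  $(\star a)|_f$ is, and similarly for $bg = (b\star)|_g$.\<close>

definition intersection_composition ::
    "'k::field \<Rightarrow> ('a::linorder, 'k) rb \<Rightarrow> ('a, 'k) rb \<Rightarrow> 'a word \<Rightarrow> ('a, 'k) rb \<Rightarrow> bool" where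
  "intersection_composition lam f g w h \<longleftrightarrow>
     monic f \<and> monic g \<and> w \<in> Phi \<and>
     (\<exists>a\<in>Phi. \<exists>b\<in>Phi.
        of_word w = rb_mult lam (of_word (lead f)) (of_word a)
      \<and> of_word w = rb_mult lam (of_word b) (of_word (lead g))
      \<and> normal_sword lam (Gen None # embed_word a) f
      \<and> normal_sword lam (embed_word b @ [Gen None]) g
      \<and> degPX w < degPX (lead f) + degPX (lead g)
      \<and> h = rb_mult lam f (of_word a) - rb_mult lam (of_word b) g)"

definition inclusion_composition ::
    "'k::field \<Rightarrow> ('a::linorder, 'k) rb \<Rightarrow> ('a, 'k) rb \<Rightarrow> 'a word \<Rightarrow> ('a, 'k) rb \<Rightarrow> bool" where
  "inclusion_composition lam f g w h \<longleftrightarrow>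
     monic f \<and> monic g \<and> w = lead f \<and>
     (\<exists>u\<in>Phi_star. of_word w = subst_word lam (of_word (lead g)) u \<and> h = f - subst_word lam g u)"

definition trivial_mod ::
    "'k::field \<Rightarrow> ('a::linorder, 'k) rb set \<Rightarrow> 'a word \<Rightarrow> ('a, 'k) rb \<Rightarrow> bool" where
  "trivial_mod lam S w h \<longleftrightarrow>
     (\<exists>(n::nat) alpha u s.
        h = (\<Sum>i<n. rb_scale (alpha i) (subst_word lam (s i) (u i)))
      \<and> (\<forall>i<n. s i \<in> S \<and> normal_sword lam (u i) (s i)
           \<and> (\<exists>z\<in>Phi. subst_word lam (of_word (lead (s i))) (u i) = of_word z \<and> word_less z w)))"


text \<open>Compositions are formed from the monic scalar multiples of the nonzero elements of \<open>S\<close>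
  (\<open>monicize f\<close> is not monic for \<open>f = 0\<close>).\<close>

definition compositions_trivial :: "'k::field \<Rightarrow> ('a::linorder, 'k) rb set \<Rightarrow> bool" where
  "compositions_trivial lam S \<longleftrightarrow>
     (\<forall>f\<in>S. \<forall>g\<in>S. \<forall>w h.
        intersection_composition lam (monicize f) (monicize g) w h
        \<or> inclusion_composition lam (monicize f) (monicize g) w h
        \<longrightarrow> trivial_mod lam S w h)"


section \<open>The relations of the universal enveloping Rota--Baxter algebra\<close>

text \<open>An element of \<open>T\<close>, expanded in the basis \<open>x\<close> and regarded as an element of \<open>RB(X)\<close>.\<close>

definition as_rb ::
    "('k::field \<Rightarrow> 't::ab_group_add \<Rightarrow> 't) \<Rightarrow> ('i \<Rightarrow> 't) \<Rightarrow> 't \<Rightarrow> ('i, 'k) rb" where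
  "as_rb scale x t =
     (\<Sum>n\<in>{n. module.representation scale (range x) t (x n) \<noteq> 0}.
        rb_scale (module.representation scale (range x) t (x n)) (of_word [Gen n]))"

text \<open>For \<open>lam = 0\<close> the third family degenerates to $-\langle x_i,x_j\rangle$ and the compositions
  $x_iP(x_j)x_k$ of the first two families are not trivial in general.  Example: \<open>T\<close> spanned by \<open>x\<close>
  with \<open>prec x x = x\<close>, \<open>succ x x = circ x x = 0\<close>, where $w = xP(x)x$ has composition $-xx$.\<close>

definition trialgebra_relations ::
    "('k::field \<Rightarrow> 't::ab_group_add \<Rightarrow> 't) \<Rightarrow> ('t \<Rightarrow> 't \<Rightarrow> 't) \<Rightarrow> ('t \<Rightarrow> 't \<Rightarrow> 't) \<Rightarrow> ('t \<Rightarrow> 't \<Rightarrow> 't)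
      \<Rightarrow> ('i \<Rightarrow> 't) \<Rightarrow> 'k \<Rightarrow> ('i, 'k) rb set" where
  "trialgebra_relations scale prec succ circ x lam =
     (\<Union>i j. {rb_mult lam (of_word [Gen i]) (rb_P (of_word [Gen j])) - as_rb scale x (prec (x i) (x j)),
             rb_mult lam (rb_P (of_word [Gen i])) (of_word [Gen j]) - as_rb scale x (succ (x i) (x j)),
             rb_scale lam (rb_mult lam (of_word [Gen i]) (of_word [Gen j]))
               - as_rb scale x (circ (x i) (x j))})"

lemma lookup_rb_scale [simp]:
  "Poly_Mapping.lookup (rb_scale c f) u = c * Poly_Mapping.lookup f u"
  unfolding rb_scale_def by (simp add: Poly_Mapping.map.rep_eq when_def)

lemma lin_ext_of_word [simp]: "lin_ext h (of_word u) = h u"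
  unfolding lin_ext_def of_word_def by (auto intro!: poly_mapping_eqI)

lemma rb_P_of_word [simp]: "rb_P (of_word u) = of_word [PP u]"
  by (simp add: rb_P_def)

lemma rb_mult_of_word [simp]: "rb_mult lam (of_word u) (of_word v) = word_mult lam u v"
  by (simp add: rb_mult_def)

lemma RB_iff: "f \<in> RB \<longleftrightarrow> (\<forall>u. u \<notin> Phi \<longrightarrow> Poly_Mapping.lookup f u = 0)"
  by (auto simp: RB_def in_keys_iff)

lemma RB_closed:
  "f \<in> RB \<Longrightarrow> g \<in> RB \<Longrightarrow> f - g \<in> RB" "f \<in> RB \<Longrightarrow> rb_scale c f \<in> RB" "of_word u \<in> RB \<longleftrightarrow> u \<in> Phi"
  "(\<And>i. i \<in> A \<Longrightarrow> h i \<in> RB) \<Longrightarrow> sum h A \<in> RB"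
  by (simp_all add: RB_iff lookup_minus lookup_sum) (auto simp: of_word_def lookup_single when_def)

lemma trialgebra_relations_subset_RB:
  "trialgebra_relations scale prec succ circ (x :: 'i \<Rightarrow> _) lam \<subseteq> RB"
proof -
  have "[Gen i] \<in> Phi_level 0" "[Gen i, Gen j] \<in> Phi_level 0"
    "[Gen i, PP [Gen j]] \<in> Phi_level (Suc 0)" "[PP [Gen i], Gen j] \<in> Phi_level (Suc 0)" for i j :: 'i
    by simp_all
  then have "[Gen i] \<in> Phi" "[Gen i, Gen j] \<in> Phi" "[Gen i, PP [Gen j]] \<in> Phi"
    "[PP [Gen i], Gen j] \<in> Phi" for i j :: 'i
    unfolding Phi_def by (metis UN_I UNIV_I)+
  then show ?thesis
    by (auto simp: trialgebra_relations_def as_rb_def intro!: RB_closed(1,2,4) RB_closed(3)[THEN iffD2])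
qed

end

theory Submission
  imports Defs
begin

text \<open>The relations have the leading words $x_iP(x_j)$, $P(x_i)x_j$ and $x_ix_j$, with two letters
  from $X$ each.  The $X$-degree is additive under the product, so an inclusion $u|_{\bar g} = \bar f$
  forces $u = \star$.  A product $P(x_i) \cdot P(v)$ or $P(v) \cdot P(x_i)$ has at least two terms, so
  the word $w$ of an intersection is obtained by concatenation and has three prime factors
  $p_1p_2p_3$.  Its composition is $p_1 \cdot t - s \cdot p_3$ with $s, t \in T$, and after reducing
  both products by the relations, extended bilinearly to $T$, one of the trialgebra axioms makes
  the two results equal.\<close>

section \<open>Linearity of the operations\<close>

lemma vector_space_rb_scale: "vector_space (rb_scale :: 'k::field \<Rightarrow> ('a, 'k) rb \<Rightarrow> ('a, 'k) rb)"
  by unfold_locales (auto intro!: poly_mapping_eqI simp: lookup_add algebra_simps)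

interpretation rb: vector_space "rb_scale :: 'k::field \<Rightarrow> ('a, 'k) rb \<Rightarrow> ('a, 'k) rb"
  by (rule vector_space_rb_scale)

lemma keys_rb_scale_subset: "Poly_Mapping.keys (rb_scale c f) \<subseteq> Poly_Mapping.keys f"
  by (auto simp: in_keys_iff)

lemma lookup_of_word: "Poly_Mapping.lookup (of_word u) v = (if u = v then 1 else 0)"
  by (simp add: of_word_def lookup_single when_def)

lemma keys_of_word [simp]: "Poly_Mapping.keys (of_word u :: ('a, 'k::field) rb) = {u}"
  by (simp add: of_word_def)

lemma of_word_eq_iff [simp]: "of_word u = (of_word v :: ('a, 'k::field) rb) \<longleftrightarrow> u = v"
  by (metis keys_of_word singleton_inject)

text \<open>Words outside the support contribute 0, so extensions of different elements can be
  compared over one common finite set.\<close>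

lemma lin_ext_eq_sum:
  assumes "finite A" "Poly_Mapping.keys f \<subseteq> A"
  shows "lin_ext h f = (\<Sum>u\<in>A. rb_scale (Poly_Mapping.lookup f u) (h u))"
  unfolding lin_ext_def using assms by (intro sum.mono_neutral_left) (auto simp: in_keys_iff)

lemma lin_ext_add: "lin_ext h (f + g) = lin_ext h f + lin_ext h g"
proof -
  define A where "A = Poly_Mapping.keys f \<union> Poly_Mapping.keys g"
  have A: "finite A" "Poly_Mapping.keys f \<subseteq> A" "Poly_Mapping.keys g \<subseteq> A"
    "Poly_Mapping.keys (f + g) \<subseteq> A"
    using keys_add[of f g] by (auto simp: A_def)
  show ?thesis
    by (simp add: A lin_ext_eq_sum[of A] lookup_add rb.scale_left_distrib sum.distrib)
qed

lemma lin_ext_scale: "lin_ext h (rb_scale c f) = rb_scale c (lin_ext h f)"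
  by (simp add: lin_ext_eq_sum[OF finite_keys keys_rb_scale_subset] lin_ext_def[of h f]
      rb.scale_sum_right)

lemma linear_lin_ext: "Vector_Spaces.linear rb_scale rb_scale (lin_ext h)"
  by (simp add: Vector_Spaces.linear_iff vector_space_rb_scale lin_ext_add lin_ext_scale)

lemma linear_rb_P: "Vector_Spaces.linear rb_scale rb_scale rb_P"
  using linear_lin_ext by (simp add: rb_P_def[abs_def])

lemma linear_rb_mult_left: "Vector_Spaces.linear rb_scale rb_scale (\<lambda>f. rb_mult lam f g)"
  using linear_lin_ext by (simp add: rb_mult_def)

lemma linear_rb_mult_right: "Vector_Spaces.linear rb_scale rb_scale (\<lambda>g. rb_mult lam f g)"
  unfolding Vector_Spaces.linear_iff
  by (auto simp: vector_space_rb_scale rb_mult_def lin_ext_add lin_ext_scale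
      lin_ext_def[of _ f] rb.scale_right_distrib sum.distrib rb.scale_sum_right mult.commute)

lemma rb_mult_diff:
  "rb_mult lam (f - g) h = rb_mult lam f h - rb_mult lam g h"
  "rb_mult lam f (g - h) = rb_mult lam f g - rb_mult lam f h"
  using module_hom.diff[OF linear_rb_mult_left[unfolded Vector_Spaces.linear_def, THEN conjunct2, THEN conjunct2]]
    module_hom.diff[OF linear_rb_mult_right[unfolded Vector_Spaces.linear_def, THEN conjunct2, THEN conjunct2]]
  by blast+

section \<open>Supports of linear extensions\<close>

lemma keys_lin_ext: "Poly_Mapping.keys (lin_ext h f) \<subseteq> (\<Union>u\<in>Poly_Mapping.keys f. Poly_Mapping.keys (h u))"
  unfolding lin_ext_def using keys_sum keys_rb_scale_subset by fastforce

text \<open>An injective relabelling merges no two basis words, so no coefficients add up or cancel.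
  It serves for \<open>P\<close> and for surrounding a word by fixed prime factors.\<close>

lemma lookup_lin_ext_of_word:
  assumes "inj h"
  shows "Poly_Mapping.lookup (lin_ext (\<lambda>u. of_word (h u)) f) (h u) = Poly_Mapping.lookup f u"
proof -
  have "Poly_Mapping.lookup (lin_ext (\<lambda>u. of_word (h u)) f) (h u)
      = (\<Sum>v\<in>Poly_Mapping.keys f. if v = u then Poly_Mapping.lookup f v else 0)"
    by (simp add: lin_ext_def lookup_sum lookup_of_word inj_eq[OF assms] if_distrib cong: if_cong)
  then show ?thesis
    by (simp add: in_keys_iff)
qed

lemma keys_lin_ext_of_word:
  assumes "inj h"
  shows "Poly_Mapping.keys (lin_ext (\<lambda>u. of_word (h u)) f) = h ` Poly_Mapping.keys f"
  using lookup_lin_ext_of_word[OF assms, of f] keys_lin_ext[of "\<lambda>u. of_word (h u)" f]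
  by (auto simp: in_keys_iff)

lemma lookup_rb_P [simp]: "Poly_Mapping.lookup (rb_P f) [PP u] = Poly_Mapping.lookup f u"
  unfolding rb_P_def by (rule lookup_lin_ext_of_word) (auto intro: injI)

lemma keys_rb_P: "Poly_Mapping.keys (rb_P f) = (\<lambda>u. [PP u]) ` Poly_Mapping.keys f"
  unfolding rb_P_def by (rule keys_lin_ext_of_word) (auto intro: injI)


section \<open>Degrees\<close>

lemma deg_in_simps [simp]:
  "deg_in T c [] = 0"
  "deg_in T c (p # u) = deg_prime T c p + deg_in T c u"
  "deg_in T c (u @ v) = deg_in T c u + deg_in T c v"
  by (simp_all add: deg_in_def)

lemma deg_prime_PP: "deg_prime T c (PP u) = (if c then 1 else 0) + deg_in T c u"
  by (simp add: deg_in_def)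

lemma keys_prime_mult_PP_PP:
  "Poly_Mapping.keys (prime_mult lam (PP u) (PP v)) \<subseteq>
     (\<lambda>z. [PP z]) ` (Poly_Mapping.keys (word_mult lam [PP u] v)
       \<union> Poly_Mapping.keys (word_mult lam u [PP v]) \<union> Poly_Mapping.keys (word_mult lam u v))"
  unfolding image_Un keys_rb_P[symmetric] prime_mult.simps
  by (auto simp: in_keys_iff lookup_add simp del: word_mult.simps)

text \<open>The three Rota-Baxter terms have the same letters of X as P(u)P(v), but the
  \<open>lam\<close> term loses a P; hence the degree that leaves P uncounted.\<close>

lemma deg_in_mult:
  "w \<in> Poly_Mapping.keys (prime_mult lam p q) \<Longrightarrow>
     deg_in T False w = deg_prime T False p + deg_prime T False q"
  "w \<in> Poly_Mapping.keys (word_mult lam u v) \<Longrightarrow>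
     deg_in T False w = deg_in T False u + deg_in T False v"
proof (induction lam p q and lam u v arbitrary: w and w rule: prime_mult_word_mult.induct)
  case (1 lam u v)
  from subsetD[OF keys_prime_mult_PP_PP 1(4)] obtain z where z: "w = [PP z]"
    "z \<in> Poly_Mapping.keys (word_mult lam [PP u] v) \<or> z \<in> Poly_Mapping.keys (word_mult lam u [PP v])
      \<or> z \<in> Poly_Mapping.keys (word_mult lam u v)"
    by blast
  then have "deg_in T False z = deg_in T False u + deg_in T False v"
    using 1(1-3)[of z] by (auto simp: deg_prime_PP simp del: deg_prime.simps word_mult.simps)
  with z(1) show ?case
    by (simp add: deg_prime_PP del: deg_prime.simps)
next
  case (3 lam u v)
  then have "u \<noteq> []" "v \<noteq> []"
    by (auto split: if_splits)
  with 3(2) obtain z where z: "z \<in> Poly_Mapping.keys (prime_mult lam (last u) (hd v))"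
      "w = butlast u @ z @ tl v"
    using keys_lin_ext[of "\<lambda>z. of_word (butlast u @ z @ tl v)"] by fastforce
  have "deg_in T False u = deg_in T False (butlast u) + deg_prime T False (last u)"
    using \<open>u \<noteq> []\<close> by (subst append_butlast_last_id[symmetric]) (simp_all del: append_butlast_last_id)
  moreover have "deg_in T False v = deg_prime T False (hd v) + deg_in T False (tl v)"
    using \<open>v \<noteq> []\<close> by (cases v) simp_all
  ultimately show ?case
    using 3(1)[of z] \<open>u \<noteq> []\<close> \<open>v \<noteq> []\<close> z by simp
qed auto

lemma deg_in_rb_mult:
  assumes "w \<in> Poly_Mapping.keys (rb_mult lam f g)"
  obtains u v where "u \<in> Poly_Mapping.keys f" "v \<in> Poly_Mapping.keys g"
    "deg_in T False w = deg_in T False u + deg_in T False v"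
proof -
  from assms obtain u where u: "u \<in> Poly_Mapping.keys f"
      "w \<in> Poly_Mapping.keys (lin_ext (\<lambda>v. word_mult lam u v) g)"
    using keys_lin_ext unfolding rb_mult_def by fast
  then obtain v where "v \<in> Poly_Mapping.keys g" "w \<in> Poly_Mapping.keys (word_mult lam u v)"
    using keys_lin_ext by fast
  with u that show ?thesis
    using deg_in_mult(2) by blast
qed

text \<open>Replacing each $\star$ by a word \<open>v\<close> raises the \<open>X\<close>-degree by \<open>deg v - 1\<close>; the equation
  is arranged so that no subtraction occurs.\<close>

lemma deg_in_subst:
  "w \<in> Poly_Mapping.keys (subst_prime lam (of_word v) p) \<Longrightarrow>
     deg_in UNIV False w + deg_prime {None} False p
       = deg_prime UNIV False p + deg_in UNIV False v * deg_prime {None} False p"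
  "w \<in> Poly_Mapping.keys (subst_word lam (of_word v) u) \<Longrightarrow>
     deg_in UNIV False w + deg_in {None} False u
       = deg_in UNIV False u + deg_in UNIV False v * deg_in {None} False u"
proof (induction lam "of_word v :: ('a, 'b) rb" p and lam "of_word v :: ('a, 'b) rb" u
    arbitrary: w and w rule: subst_prime_subst_word.induct)
  case (6 lam p q u)
  from 6(3) obtain w1 w2 where
    "w1 \<in> Poly_Mapping.keys (subst_prime lam (of_word v) p)"
    "w2 \<in> Poly_Mapping.keys (subst_word lam (of_word v) (q # u))"
    "deg_in UNIV False w = deg_in UNIV False w1 + deg_in UNIV False w2"
    by (auto elim: deg_in_rb_mult[where T = UNIV])
  with 6(1)[of w1] 6(2)[of w2] show ?case
    by (simp add: algebra_simps)
qed (auto simp: keys_rb_P deg_prime_PP simp del: deg_prime.simps(2))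

lemma length_le_deg_in: "(\<And>p. p \<in> set u \<Longrightarrow> 1 \<le> deg_prime T c p) \<Longrightarrow> length u \<le> deg_in T c u"
proof (induction u)
  case (Cons p u)
  then have "length u \<le> deg_in T c u" "1 \<le> deg_prime T c p"
    by simp_all
  then show ?case by simp
qed simp

text \<open>Every prime factor contributes a letter: in \<open>PP z\<close> the word
  \<open>z\<close> is nonempty and, by induction, has at least \<open>length z\<close>
  letters.\<close>

lemma Phi_level_length_le: "u \<in> Phi_level n \<Longrightarrow> u \<noteq> [] \<and> length u \<le> deg_in UNIV False u"
proof (induction n arbitrary: u)
  case 0
  then have "1 \<le> deg_prime UNIV False p" if "p \<in> set u" for p
    using that by auto
  then have "length u \<le> deg_in UNIV False u"
    by (rule length_le_deg_in)
  with 0 show ?case by simp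
next
  case (Suc n)
  have "1 \<le> deg_prime UNIV False p" if "p \<in> set u" for p
  proof -
    from that Suc.prems have "p \<in> range Gen \<union> PP ` Phi_level n"
      by auto
    then consider y where "p = Gen y" | z where "p = PP z" "z \<in> Phi_level n"
      by blast
    then show ?thesis
    proof cases
      case 2
      from Suc.IH[OF 2(2)] have "0 < length z" "length z \<le> deg_in UNIV False z"
        by simp_all
      then show ?thesis
        unfolding 2(1) deg_prime_PP by linarith
    qed simp
  qed
  then have "length u \<le> deg_in UNIV False u"
    by (rule length_le_deg_in)
  with Suc.prems show ?case by simp
qed

lemma Phi_length_le: "u \<in> Phi \<Longrightarrow> length u \<le> deg_in UNIV False u"
  and Phi_not_Nil: "u \<in> Phi \<Longrightarrow> u \<noteq> []"
  unfolding Phi_def using Phi_level_length_le by blast+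

section \<open>Leading words detected by degree\<close>

lemma word_less_degPX: "word_less u v \<Longrightarrow> degPX u \<le> degPX v"
  by (induction rule: word_less.induct) (auto simp: Deg_def degPX_def)

lemma degPX_word_less: "degPX u < degPX v \<Longrightarrow> word_less u v"
  by (rule word_less.deg) (simp add: Deg_def)

text \<open>A rival \<open>v\<close> for the definite description would satisfy
  \<open>word_less u v\<close>, hence \<open>degPX u \<le> degPX v\<close>, against the strict
  degree bound.\<close>

lemma lead_eqI:
  assumes "u \<in> Poly_Mapping.keys f"
    "\<And>v. v \<in> Poly_Mapping.keys f \<Longrightarrow> v \<noteq> u \<Longrightarrow> degPX v < degPX u"
  shows "lead f = u"
  unfolding lead_def
proof (rule the_equality)
  show "u \<in> Poly_Mapping.keys f \<and> (\<forall>v\<in>Poly_Mapping.keys f. v \<noteq> u \<longrightarrow> word_less v u)"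
    using assms degPX_word_less by blast
  fix v assume "v \<in> Poly_Mapping.keys f \<and> (\<forall>u\<in>Poly_Mapping.keys f. u \<noteq> v \<longrightarrow> word_less u v)"
  then have v: "v \<in> Poly_Mapping.keys f" "v \<noteq> u \<Longrightarrow> word_less u v"
    using assms(1) by auto
  show "v = u"
    using assms(2)[OF v(1)] word_less_degPX[OF v(2)] by fastforce
qed


section \<open>Products of words that are words\<close>

lemma word_mult_Gen_left: "v \<noteq> [] \<Longrightarrow> word_mult lam [Gen i] v = of_word (Gen i # v)"
  by simp

lemma word_mult_Gen_right: "u \<noteq> [] \<Longrightarrow> word_mult lam u [Gen i] = of_word (u @ [Gen i])"
  by (cases u rule: rev_cases; cases "last u") simp_all

text \<open>Either the product is a concatenation starting with \<open>PP u\<close>, or two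
  P-factors meet and merge into words that again start with a P-factor. Such terms cannot cancel a
  word starting with a generator.\<close>

lemma keys_word_mult_PP_left:
  assumes "z \<in> Poly_Mapping.keys (word_mult lam [PP u] v)"
  shows "is_PP (hd z)"
proof (cases "hd v")
  case (PP v')
  have "v \<noteq> []"
    using assms by auto
  then obtain y where "y \<in> Poly_Mapping.keys (prime_mult lam (PP u) (PP v'))" "z = y @ tl v"
    using assms keys_lin_ext[of "\<lambda>z. of_word (z @ tl v)"] PP by (fastforce simp del: prime_mult.simps)
  then show ?thesis
    using keys_prime_mult_PP_PP[of lam u v'] by auto
qed (use assms in \<open>auto split: if_splits\<close>)

lemma keys_word_mult_PP_right:
  assumes "z \<in> Poly_Mapping.keys (word_mult lam u [PP v])"
  shows "is_PP (last z)"
proof (cases "last u")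
  case (PP u')
  have "u \<noteq> []"
    using assms by auto
  then obtain y where "y \<in> Poly_Mapping.keys (prime_mult lam (PP u') (PP v))" "z = butlast u @ y"
    using assms keys_lin_ext[of "\<lambda>z. of_word (butlast u @ z)"] PP by (fastforce simp del: prime_mult.simps)
  then show ?thesis
    using keys_prime_mult_PP_PP[of lam u' v] by auto
qed (use assms in \<open>auto split: if_splits\<close>)

text \<open>Compare sizes. This separates x_i P(v) from x_i v, and P(u) x_i from u x_i.\<close>

lemma neq_PP_self [simp]: "v \<noteq> [PP v]" "[PP v] \<noteq> v" for v :: "'a word"
proof -
  show "v \<noteq> [PP v]"
  proof
    assume "v = [PP v]"
    then have "size_list size v = size_list size [PP v]"
      by simp
    then show False
      by simp
  qed
  then show "[PP v] \<noteq> v"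
    by (rule not_sym)
qed

text \<open>The product $P(x_j) \cdot P(v)$ has the two different terms $P(x_j P(v))$ and
  $\lambda P(x_j v)$.\<close>

lemma prime_mult_word:
  assumes "lam \<noteq> 0" "Poly_Mapping.keys (prime_mult lam p q) = {z}"
    and "p \<noteq> PP []" "q \<noteq> PP []"
    and "\<exists>i. p \<in> {Gen i, PP [Gen i]} \<or> q \<in> {Gen i, PP [Gen i]}"
  shows "z = [p, q]"
proof (cases "is_PP p \<and> is_PP q")
  case False
  then show ?thesis
    using assms(2) by (cases p; cases q) auto
next
  case True
  then obtain u v where uv: "p = PP u" "q = PP v"
    by (meson prime.collapse(2) is_PP_def)
  then have ne: "u \<noteq> []" "v \<noteq> []"
    using assms(3,4) by auto
  from uv assms(5) consider i where "u = [Gen i]" | i where "v = [Gen i]"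
    by auto
  then show ?thesis
  proof cases
    case 1
    \<comment> \<open>The first Rota-Baxter term has only words starting with a P-factor under its
      outer P, so it cannot cancel the two words starting with x_i.\<close>
    have "z \<notin> Poly_Mapping.keys (word_mult lam [PP u] v)" if "hd z = Gen i" for z
      using keys_word_mult_PP_left[of z lam u v] that by auto
    then have "Poly_Mapping.lookup (word_mult lam [PP u] v) [Gen i, PP v] = 0"
        "Poly_Mapping.lookup (word_mult lam [PP u] v) (Gen i # v) = 0"
      by (simp_all add: in_keys_iff)
    moreover have "word_mult lam u [PP v] = of_word [Gen i, PP v]"
        "word_mult lam u v = of_word (Gen i # v)"
      using ne by (simp_all add: 1 word_mult_Gen_left del: word_mult.simps)
    \<comment> \<open>The two coefficients are 1 and \<open>lam\<close>; the second word survives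
      because \<open>lam\<close> is nonzero.\<close>
    ultimately have "{[PP [Gen i, PP v]], [PP (Gen i # v)]} \<subseteq> Poly_Mapping.keys (prime_mult lam p q)"
      using \<open>lam \<noteq> 0\<close>
      by (simp add: uv in_keys_iff lookup_add lookup_of_word del: word_mult.simps)
    moreover have "[PP [Gen i, PP v]] \<noteq> [PP (Gen i # v)]"
      by simp
    ultimately show ?thesis
      unfolding assms(2) by (metis insert_subset singletonD)
  next
    case 2
    have "z \<notin> Poly_Mapping.keys (word_mult lam u [PP v])" if "last z = Gen i" for z
      using keys_word_mult_PP_right[of z lam u v] that by auto
    then have "Poly_Mapping.lookup (word_mult lam u [PP v]) [PP u, Gen i] = 0"
        "Poly_Mapping.lookup (word_mult lam u [PP v]) (u @ [Gen i]) = 0"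
      by (simp_all add: in_keys_iff)
    moreover have "word_mult lam [PP u] v = of_word [PP u, Gen i]"
        "word_mult lam u v = of_word (u @ [Gen i])"
      using ne by (simp_all add: 2 word_mult_Gen_right del: word_mult.simps)
    moreover have neq: "u @ [Gen i] \<noteq> [PP u, Gen i]"
      using neq_PP_self(1)[of u] by (metis append_Cons append_Nil append_same_eq)
    ultimately have "{[PP [PP u, Gen i]], [PP (u @ [Gen i])]} \<subseteq> Poly_Mapping.keys (prime_mult lam p q)"
      using \<open>lam \<noteq> 0\<close> neq neq[symmetric]
      by (simp add: uv in_keys_iff lookup_add lookup_of_word del: word_mult.simps)
    with neq show ?thesis
      unfolding assms(2) by (metis insert_subset singletonD list.inject prime.inject(2))
  qed
qed

text \<open>Only \<open>last u\<close> and \<open>hd v\<close> interact, and the surrounding factors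
  form an injective context. So a product that is a single word comes from a single-word product of
  these two primes, which is a concatenation by \<open>prime_mult_word\<close>.\<close>

lemma word_mult_eq_of_word:
  assumes "lam \<noteq> 0" "word_mult lam u v = of_word w"
    and "u \<noteq> []" "v \<noteq> []" "PP [] \<notin> set u" "PP [] \<notin> set v"
    and "\<exists>i. last u \<in> {Gen i, PP [Gen i]} \<or> hd v \<in> {Gen i, PP [Gen i]}"
  shows "w = u @ v"
proof -
  have "inj (\<lambda>z. butlast u @ z @ tl v)"
    by (auto intro: injI)
  then have "(\<lambda>z. butlast u @ z @ tl v) ` Poly_Mapping.keys (prime_mult lam (last u) (hd v)) = {w}"
    using assms(2-4) by (simp flip: keys_lin_ext_of_word)
  then obtain z where "Poly_Mapping.keys (prime_mult lam (last u) (hd v)) = {z}" and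
      w: "w = butlast u @ z @ tl v"
    by (smt (verit) \<open>inj _\<close> image_insert image_empty inj_image_eq_iff image_iff singletonI)
  moreover have "last u \<noteq> PP []" "hd v \<noteq> PP []"
    using assms by (metis last_in_set, metis hd_in_set)
  ultimately have "z = [last u, hd v]"
    using assms prime_mult_word by blast
  then show ?thesis
    using w assms(3,4) by (cases u rule: rev_cases; cases v) simp_all
qed

text \<open>\<open>word_mult\<close> is 0 on the empty word, so a factor \<open>PP []\<close> would
  spoil the argument that a product of two P-factors has two terms. The levels of \<open>Phi\<close>
  apply \<open>PP\<close> to nonempty words only.\<close>

lemma PP_Nil_notin_Phi: "u \<in> Phi \<Longrightarrow> PP [] \<notin> set u"
proof -
  have "PP [] \<notin> set u" if "u \<in> Phi_level n" for n
  proof (cases n)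
    case (Suc m)
    have "[] \<notin> (Phi_level m :: 'a word set)"
      using Phi_level_length_le by blast
    with that Suc show ?thesis by auto
  qed (use that in auto)
  then show "u \<in> Phi \<Longrightarrow> PP [] \<notin> set u"
    by (auto simp: Phi_def)
qed


section \<open>Trivial compositions\<close>

text \<open>The admissible summands of \<open>trivial_mod\<close>, collected so that triviality
  follows from membership in their span and subspace closure can be used.\<close>

definition normal_multiples ::
    "'k::field \<Rightarrow> ('a::linorder, 'k) rb set \<Rightarrow> 'a word \<Rightarrow> ('a, 'k) rb set" where
  "normal_multiples lam S w = {subst_word lam s u | s u z. s \<in> S \<and> normal_sword lam u s
     \<and> z \<in> Phi \<and> subst_word lam (of_word (lead s)) u = of_word z \<and> word_less z w}"

lemma trivial_modI:
  assumes "h \<in> rb.span (normal_multiples lam S w)"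
  shows "trivial_mod lam S w h"
proof -
  obtain A r where A: "finite A" "A \<subseteq> normal_multiples lam S w" "h = (\<Sum>a\<in>A. rb_scale (r a) a)"
    using assms by (auto simp: rb.span_explicit)
  \<comment> \<open>Numbering the finite set of summands gives the indexed sum that
    \<open>trivial_mod\<close> asks for.\<close>
  obtain e where e: "bij_betw e {..<card A} A"
    using ex_bij_betw_nat_finite[OF A(1)] by (auto simp: atLeast0LessThan)
  have "\<forall>i\<in>{..<card A}. \<exists>s u. e i = subst_word lam s u \<and> s \<in> S \<and> normal_sword lam u s \<and>
      (\<exists>z\<in>Phi. subst_word lam (of_word (lead s)) u = of_word z \<and> word_less z w)"
  proof
    fix i assume "i \<in> {..<card A}"
    then have "e i \<in> normal_multiples lam S w"
      using A(2) e by (auto simp: bij_betw_def)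
    then show "\<exists>s u. e i = subst_word lam s u \<and> s \<in> S \<and> normal_sword lam u s \<and>
      (\<exists>z\<in>Phi. subst_word lam (of_word (lead s)) u = of_word z \<and> word_less z w)"
      unfolding normal_multiples_def by blast
  qed
  then obtain s u where su: "\<And>i. i < card A \<Longrightarrow> e i = subst_word lam (s i) (u i) \<and> s i \<in> S \<and>
      normal_sword lam (u i) (s i) \<and>
      (\<exists>z\<in>Phi. subst_word lam (of_word (lead (s i))) (u i) = of_word z \<and> word_less z w)"
    unfolding bchoice_iff by (metis lessThan_iff)
  have "h = (\<Sum>i<card A. rb_scale (r (e i)) (e i))"
    using A(3) by (simp add: sum.reindex_bij_betw[OF e, of "\<lambda>a. rb_scale (r a) a"])
  then have "h = (\<Sum>i<card A. rb_scale (r (e i)) (subst_word lam (s i) (u i)))"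
    using su by simp
  then show ?thesis
    unfolding trivial_mod_def using su by (intro exI[of _ "card A"] exI[of _ "\<lambda>i. r (e i)"] exI[of _ u] exI[of _ s]) blast
qed

text \<open>Take the lone star \<open>[Gen None]\<close> as context; the smaller degree puts the
  leading word below \<open>w\<close>.\<close>

lemma normal_multiples_self:
  assumes "s \<in> S" "s \<noteq> 0" "lead s \<in> Phi" "degPX (lead s) < degPX w"
  shows "s \<in> normal_multiples lam S w"
proof -
  have "[Gen None] \<in> Phi"
    unfolding Phi_def by (rule UN_I[of 0]) simp_all
  then have "[Gen None] \<in> Phi_star"
    by (simp add: Phi_star_def)
  with assms have "normal_sword lam [Gen None] s"
    by (simp add: normal_sword_def)
  then show ?thesis
    unfolding normal_multiples_def using assms degPX_word_less
    by (auto intro!: exI[of _ s] exI[of _ "[Gen None]"])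
qed

lemma two_letter_Phi:
  "[Gen i, Gen j] \<in> Phi" "[Gen i, PP [Gen j]] \<in> Phi" "[PP [Gen i], Gen j] \<in> Phi"
proof -
  have "[Gen i, Gen j] \<in> Phi_level 0" "[Gen i, PP [Gen j]] \<in> Phi_level (Suc 0)"
    "[PP [Gen i], Gen j] \<in> Phi_level (Suc 0)"
    by simp_all
  then show "[Gen i, Gen j] \<in> Phi" "[Gen i, PP [Gen j]] \<in> Phi" "[PP [Gen i], Gen j] \<in> Phi"
    unfolding Phi_def by blast+
qed


section \<open>The relations of a trialgebra\<close>

lemma linear_comp:
  "Vector_Spaces.linear s1 s2 f \<Longrightarrow> Vector_Spaces.linear s2 s3 g \<Longrightarrow>
    Vector_Spaces.linear s1 s3 (\<lambda>a. g (f a))"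
  by (simp add: Vector_Spaces.linear_iff)

lemma linear_diff_fun:
  "Vector_Spaces.linear s1 rb_scale f \<Longrightarrow> Vector_Spaces.linear s1 rb_scale g \<Longrightarrow>
    Vector_Spaces.linear s1 rb_scale (\<lambda>a. f a - g a)"
  by (simp add: Vector_Spaces.linear_iff rb.scale_right_diff_distrib)

lemma linear_rb_scale: "Vector_Spaces.linear rb_scale rb_scale (rb_scale c)"
  by (simp add: Vector_Spaces.linear_iff vector_space_rb_scale rb.scale_right_distrib mult.commute)

locale based_trialgebra = dendriform_trialgebra scale prec succ circ
  for scale :: "'k::field \<Rightarrow> 't::ab_group_add \<Rightarrow> 't" and prec succ circ +
  fixes x :: "'i::linorder \<Rightarrow> 't" and lam :: 'k
  assumes basis: "indexed_basis scale x"
    and lam: "lam \<noteq> 0"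
begin

abbreviation emb :: "'t \<Rightarrow> ('i, 'k) rb" where
  "emb \<equiv> as_rb scale x"

abbreviation mul :: "('i, 'k) rb \<Rightarrow> ('i, 'k) rb \<Rightarrow> ('i, 'k) rb"  (infixl "\<cdot>" 70) where
  "f \<cdot> g \<equiv> rb_mult lam f g"

abbreviation relations :: "('i, 'k) rb set" where
  "relations \<equiv> trialgebra_relations scale prec succ circ x lam"

lemma inj_x: "inj x" and independent_x: "independent (range x)" and span_x: "span (range x) = UNIV"
  using basis by (auto simp: indexed_basis_def)

section \<open>The embedding of T into RB(X) and the monic relations\<close>

lemma lookup_emb:
  "Poly_Mapping.lookup (emb t) u
    = (case u of [Gen n] \<Rightarrow> representation (range x) t (x n) | _ \<Rightarrow> 0)"
proof -
  define A where "A = {n. representation (range x) t (x n) \<noteq> 0}"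
  \<comment> \<open>Over an infinite index set the sum in \<open>as_rb\<close> would default to 0;
    injectivity of \<open>x\<close> carries over the finiteness of the representation.\<close>
  have "finite A"
    using finite_vimageI[OF finite_representation inj_x] by (simp add: A_def vimage_def)
  then show ?thesis
    by (auto simp: as_rb_def lookup_sum lookup_of_word A_def[symmetric] if_distrib cong: if_cong
        split: list.split prime.split) (auto simp: A_def)
qed

lemma keys_emb: "Poly_Mapping.keys (emb t) \<subseteq> range (\<lambda>n. [Gen n])"
  by (auto simp: in_keys_iff lookup_emb split: list.splits prime.splits)

lemma linear_emb: "Vector_Spaces.linear scale rb_scale emb"
  by (auto simp: Vector_Spaces.linear_iff vector_space_rb_scale vector_space_axioms lookup_add lookup_emb
      representation_add representation_scale independent_x span_x
      intro!: poly_mapping_eqI split: list.split prime.split)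

lemma emb_x [simp]: "emb (x i) = of_word [Gen i]"
  by (auto simp: lookup_emb lookup_of_word representation_basis independent_x inj_eq[OF inj_x]
      intro!: poly_mapping_eqI split: list.split prime.split)

text \<open>The words of \<open>emb t\<close> are single letters, so they can neither cancel nor
  exceed \<open>u\<close>, whose degree is larger than 1.\<close>

lemma lead_relation:
  assumes "c \<noteq> 0" "1 < degPX u"
  shows "lead (rb_scale c (of_word u) - emb t) = u"
    and "Poly_Mapping.lookup (rb_scale c (of_word u) - emb t) u = c"
proof -
  have deg: "degPX v = 1" if "v \<in> Poly_Mapping.keys (emb t)" for v
    using that keys_emb[of t] by (auto simp: degPX_def)
  then show *: "Poly_Mapping.lookup (rb_scale c (of_word u) - emb t) u = c"
    using assms(2) deg[of u] by (fastforce simp: lookup_minus lookup_of_word in_keys_iff)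
  show "lead (rb_scale c (of_word u) - emb t) = u"
  proof (rule lead_eqI)
    show "u \<in> Poly_Mapping.keys (rb_scale c (of_word u) - emb t)"
      using * assms(1) by (simp add: in_keys_iff)
    fix v assume "v \<in> Poly_Mapping.keys (rb_scale c (of_word u) - emb t)" "v \<noteq> u"
    then have "v \<in> Poly_Mapping.keys (emb t)"
      by (auto simp: in_keys_iff lookup_minus lookup_of_word)
    then show "degPX v < degPX u"
      using deg assms(2) by simp
  qed
qed

lemma monicize_relation:
  assumes "c \<noteq> 0" "1 < degPX u"
  shows "monicize (rb_scale c (of_word u) - emb t) = of_word u - emb (scale (inverse c) t)"
  using assms linear_emb
  by (simp add: monicize_def lead_relation rb.scale_right_diff_distrib Vector_Spaces.linear_iff)

text \<open>The monic relations read as rules replacing the word \<open>[p, q]\<close> by the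
  element \<open>t\<close> of T; the third family has been divided by \<open>lam\<close>.\<close>

inductive rewrite_to :: "'i prime \<Rightarrow> 'i prime \<Rightarrow> 't \<Rightarrow> bool" where
  "rewrite_to (Gen i) (PP [Gen j]) (prec (x i) (x j))"
| "rewrite_to (PP [Gen i]) (Gen j) (succ (x i) (x j))"
| "rewrite_to (Gen i) (Gen j) (scale (inverse lam) (circ (x i) (x j)))"

lemma monicize_relations:
  assumes "f \<in> relations"
  obtains (rewrite_to_lead) p q t where "rewrite_to p q t" "monicize f = of_word [p, q] - emb t"
    "lead (monicize f) = [p, q]"
proof -
  \<comment> \<open>The factor \<open>c\<close> is 1 for the first two families and
    \<open>lam\<close> for the third, so all three are normalised at once.\<close>
  have *: thesis if "f = rb_scale c (of_word [p, q]) - emb t" "c \<noteq> 0" "1 < degPX [p, q]"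
    "rewrite_to p q (scale (inverse c) t)" for c p q t
    using that monicize_relation[of c "[p, q]" t] lead_relation(1)[of 1 "[p, q]" "scale (inverse c) t"]
    by (intro rewrite_to_lead) simp_all
  from assms consider
      i j where "f = rb_scale 1 (of_word [Gen i, PP [Gen j]]) - emb (prec (x i) (x j))"
    | i j where "f = rb_scale 1 (of_word [PP [Gen i], Gen j]) - emb (succ (x i) (x j))"
    | i j where "f = rb_scale lam (of_word [Gen i, Gen j]) - emb (circ (x i) (x j))"
    by (auto simp: trialgebra_relations_def)
  then show thesis
    by cases (erule *; simp add: degPX_def lam rewrite_to.intros)+
qed

section \<open>Reduction of products by the relations, extended bilinearly\<close>

lemma linear_span:
  assumes "Vector_Spaces.linear scale rb_scale f" "\<And>i. f (x i) \<in> rb.span N"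
  shows "f t \<in> rb.span N"
proof -
  have lin: "f (a + b) = f a + f b" "f (scale c a) = rb_scale c (f a)" for a b c
    using assms(1) by (simp_all add: Vector_Spaces.linear_iff)
  have "f 0 = 0"
    using lin(1)[of 0 0] by simp
  have "t \<in> span (range x)"
    by (simp add: span_x)
  then show ?thesis
  proof (induction rule: span_induct_alt)
    case (step c v w)
    then show ?case
      using assms(2) by (auto simp: lin intro!: rb.span_add rb.span_scale)
  qed (simp add: \<open>f 0 = 0\<close> rb.span_zero)
qed

text \<open>In an overlap one factor is a general element of T, such as
  \<open>succ (x j) (x k)\<close>; bilinearity passes from the relations on basis elements to such
  factors.\<close>

lemma bilinear_span:
  assumes "\<And>t. Vector_Spaces.linear scale rb_scale (B t)"
    and "\<And>t. Vector_Spaces.linear scale rb_scale (\<lambda>s. B s t)"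
    and "\<And>i j. B (x i) (x j) \<in> rb.span N"
  shows "B s t \<in> rb.span N"
  using linear_span[of "\<lambda>s. B s t"] linear_span[of "B (x _)"] assms by blast

lemmas linear_intros =
  linear_diff_fun linear_emb
  linear_comp[OF linear_emb linear_rb_P] linear_comp[OF _ linear_emb] linear_comp[OF _ linear_rb_scale]
  linear_comp[OF _ linear_rb_mult_left] linear_comp[OF _ linear_rb_mult_right]
  linear_prec_left linear_prec_right linear_succ_left linear_succ_right
  linear_circ_left linear_circ_right

lemma relation_in_normal_multiples:
  assumes "rb_scale c (of_word u) - emb t \<in> relations" "c \<noteq> 0" "1 < degPX u" "u \<in> Phi"
    "degPX u < degPX w"
  shows "rb_scale c (of_word u) - emb t \<in> rb.span (normal_multiples lam relations w)"
  using assms lead_relation[of c u t]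
  by (intro rb.span_base normal_multiples_self) auto

text \<open>The bound 3 is the degree of x_i P(x_j), which has two letters and one P, so the
  relations used have leading words below \<open>w\<close>.\<close>

lemma relation_prec:
  assumes "3 < degPX w"
  shows "emb s \<cdot> rb_P (emb t) - emb (prec s t) \<in> rb.span (normal_multiples lam relations w)"
proof (rule bilinear_span[where B = "\<lambda>s t. emb s \<cdot> rb_P (emb t) - emb (prec s t)"])
  show "emb (x i) \<cdot> rb_P (emb (x j)) - emb (prec (x i) (x j))
      \<in> rb.span (normal_multiples lam relations w)" for i j
    using relation_in_normal_multiples[of 1 "[Gen i, PP [Gen j]]" "prec (x i) (x j)" w] assms
    by (auto simp: trialgebra_relations_def degPX_def two_letter_Phi)
qed (intro linear_intros)+

lemma relation_succ:
  assumes "3 < degPX w"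
  shows "rb_P (emb s) \<cdot> emb t - emb (succ s t) \<in> rb.span (normal_multiples lam relations w)"
proof (rule bilinear_span[where B = "\<lambda>s t. rb_P (emb s) \<cdot> emb t - emb (succ s t)"])
  show "rb_P (emb (x i)) \<cdot> emb (x j) - emb (succ (x i) (x j))
      \<in> rb.span (normal_multiples lam relations w)" for i j
    using relation_in_normal_multiples[of 1 "[PP [Gen i], Gen j]" "succ (x i) (x j)" w] assms
    by (auto simp: trialgebra_relations_def degPX_def two_letter_Phi)
qed (intro linear_intros)+

lemma relation_circ:
  assumes "2 < degPX w"
  shows "emb s \<cdot> emb t - emb (scale (inverse lam) (circ s t))
    \<in> rb.span (normal_multiples lam relations w)"
proof -
  have "rb_scale lam (emb s \<cdot> emb t) - emb (circ s t) \<in> rb.span (normal_multiples lam relations w)"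
  proof (rule bilinear_span[where B = "\<lambda>s t. rb_scale lam (emb s \<cdot> emb t) - emb (circ s t)"])
    show "rb_scale lam (emb (x i) \<cdot> emb (x j)) - emb (circ (x i) (x j))
        \<in> rb.span (normal_multiples lam relations w)" for i j
      using relation_in_normal_multiples[of lam "[Gen i, Gen j]" "circ (x i) (x j)" w] assms lam
      by (auto simp: trialgebra_relations_def degPX_def two_letter_Phi)
  qed (intro linear_intros)+
  \<comment> \<open>The relations control \<open>lam\<close> times the product; as spans are closed
    under scaling, \<open>lam\<close> can be divided out.\<close>
  then have "rb_scale (inverse lam) (rb_scale lam (emb s \<cdot> emb t) - emb (circ s t))
      \<in> rb.span (normal_multiples lam relations w)"
    by (rule rb.span_scale)
  then show ?thesis
    using linear_emb lam by (simp add: rb.scale_right_diff_distrib Vector_Spaces.linear_iff)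
qed

section \<open>Overlaps, intersections and inclusions of leading words\<close>

lemma overlap_trivial:
  assumes "rewrite_to p1 p2 s" "rewrite_to p2 p3 t"
  shows "of_word [p1] \<cdot> emb t - emb s \<cdot> of_word [p3]
    \<in> rb.span (normal_multiples lam relations [p1, p2, p3])"
proof -
  let ?N = "rb.span (normal_multiples lam relations [p1, p2, p3])"
  \<comment> \<open>Each product reduces to an element of T; the span contains their difference once
    the two reduced elements agree.\<close>
  have diffI: "f - g \<in> ?N" if "f - emb r \<in> ?N" "g - emb r' \<in> ?N" "r = r'" for f g r r'
    using rb.span_diff[OF that(1,2)] that(3) by simp
  \<comment> \<open>Of the nine pairs of rules, five agree in the middle prime
    \<open>p2\<close>.\<close>
  from assms consider
      i j k where "p1 = Gen i" "p2 = PP [Gen j]" "p3 = Gen k"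
        "s = prec (x i) (x j)" "t = succ (x j) (x k)"
    | i j k where "p1 = PP [Gen i]" "p2 = Gen j" "p3 = PP [Gen k]"
        "s = succ (x i) (x j)" "t = prec (x j) (x k)"
    | i j k where "p1 = PP [Gen i]" "p2 = Gen j" "p3 = Gen k"
        "s = succ (x i) (x j)" "t = scale (inverse lam) (circ (x j) (x k))"
    | i j k where "p1 = Gen i" "p2 = Gen j" "p3 = PP [Gen k]"
        "s = scale (inverse lam) (circ (x i) (x j))" "t = prec (x j) (x k)"
    | i j k where "p1 = Gen i" "p2 = Gen j" "p3 = Gen k"
        "s = scale (inverse lam) (circ (x i) (x j))" "t = scale (inverse lam) (circ (x j) (x k))"
    by (auto elim!: rewrite_to.cases)
  then show ?thesis
  proof cases
    \<comment> \<open>Both rules absorb the middle P, so two plain products remain. Both reduce by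
      \<open>circ\<close>, and \<open>prec_circ\<close> equates the results.\<close>
    case 1
    show ?thesis
      using diffI[OF relation_circ[of _ "x i" t] relation_circ[of _ s "x k"]] 1
      by (simp add: degPX_def prec_circ)
  next
    case 2
    show ?thesis
      using diffI[OF relation_succ[of _ "x i" t] relation_prec[of _ s "x k"]] 2
      by (simp add: degPX_def succ_prec)
  next
    case 3
    show ?thesis
      using diffI[OF relation_succ[of _ "x i" t] relation_circ[of _ s "x k"]] 3 linear_succ_right
      by (simp add: degPX_def succ_circ Vector_Spaces.linear_iff)
  next
    case 4
    show ?thesis
      using diffI[OF relation_circ[of _ "x i" t] relation_prec[of _ s "x k"]] 4 linear_prec_left
      by (simp add: degPX_def circ_prec Vector_Spaces.linear_iff)
  next
    \<comment> \<open>Both reduced elements carry \<open>inverse lam\<close> twice, once from the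
      rule and once from the second reduction.\<close>
    case 5
    show ?thesis
      using diffI[OF relation_circ[of _ "x i" t] relation_circ[of _ s "x k"]] 5
        linear_circ_left linear_circ_right
      by (simp add: degPX_def circ_circ Vector_Spaces.linear_iff)
  qed
qed

lemma rewrite_to_unique: "rewrite_to p q s \<Longrightarrow> rewrite_to p q t \<Longrightarrow> s = t"
  by (auto elim!: rewrite_to.cases)

lemma rewrite_to_primes:
  assumes "rewrite_to p q t"
  shows "PP [] \<notin> set [p, q]" "\<exists>i. p \<in> {Gen i, PP [Gen i]}" "\<exists>i. q \<in> {Gen i, PP [Gen i]}"
    "deg_in UNIV False [p, q] = 2"
  using assms by (auto elim!: rewrite_to.cases)

lemma intersection_trivial:
  assumes "f \<in> relations" "g \<in> relations"
    and "intersection_composition lam (monicize f) (monicize g) w h"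
  shows "trivial_mod lam relations w h"
proof -
  obtain p1 p2 s where f: "rewrite_to p1 p2 s" "monicize f = of_word [p1, p2] - emb s"
      "lead (monicize f) = [p1, p2]"
    using monicize_relations[OF assms(1)] by blast
  obtain q1 q2 t where g: "rewrite_to q1 q2 t" "monicize g = of_word [q1, q2] - emb t"
      "lead (monicize g) = [q1, q2]"
    using monicize_relations[OF assms(2)] by blast
  obtain a b where ab: "a \<in> Phi" "b \<in> Phi"
    and w: "of_word w = word_mult lam [p1, p2] a" "of_word w = word_mult lam b [q1, q2]"
    and deg: "degPX w < degPX [p1, p2] + degPX [q1, q2]"
    and h: "h = monicize f \<cdot> of_word a - of_word b \<cdot> monicize g"
    using assms(3) unfolding intersection_composition_def f(3) g(3) rb_mult_of_word by blast
  \<comment> \<open>The product is a single word and \<open>p2\<close> is x_i or P(x_i), so the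
    factors are merely concatenated.\<close>
  have "w = [p1, p2] @ a"
    using w(1) lam ab(1) rewrite_to_primes[OF f(1)]
    by (intro word_mult_eq_of_word[of lam]) (auto simp: Phi_not_Nil PP_Nil_notin_Phi simp del: word_mult.simps)
  moreover have "w = b @ [q1, q2]"
    using w(2) lam ab(2) rewrite_to_primes[OF g(1)]
    by (intro word_mult_eq_of_word[of lam]) (auto simp: Phi_not_Nil PP_Nil_notin_Phi simp del: word_mult.simps)
  \<comment> \<open>Otherwise the two leading words would be disjoint in \<open>w\<close>, whose
    degree would reach the sum of theirs.\<close>
  moreover have "\<not> (\<exists>d. a = d @ [q1, q2])"
    using deg \<open>w = [p1, p2] @ a\<close> by (auto simp: degPX_def)
  moreover have "a \<noteq> []"
    using ab Phi_not_Nil by blast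
  \<comment> \<open>As \<open>w\<close> ends in q1 q2, a word \<open>a\<close> of length at least 2
    would end in q1 q2 too; so \<open>a\<close> has length 1.\<close>
  ultimately have "a = [q2]" "b = [p1]" "p2 = q1"
    by (cases a rule: rev_cases; fastforce simp: Cons_eq_append_conv append_eq_Cons_conv)+
  \<comment> \<open>Both leading words contribute \<open>of_word w\<close>, which cancels and leaves
    the remainders with the signs exchanged.\<close>
  then have "h = of_word [p1] \<cdot> emb t - emb s \<cdot> of_word [q2]"
    unfolding h f(2) g(2) rb_mult_diff rb_mult_of_word using w by (simp del: word_mult.simps)
  then show ?thesis
    using overlap_trivial[OF f(1)] g(1) \<open>p2 = q1\<close> \<open>a = [q2]\<close> \<open>w = [p1, p2] @ a\<close>
    by (auto intro: trivial_modI)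
qed

lemma inclusion_trivial:
  assumes "f \<in> relations" "g \<in> relations"
    and "inclusion_composition lam (monicize f) (monicize g) w h"
  shows "trivial_mod lam relations w h"
proof -
  obtain p1 p2 s where f: "rewrite_to p1 p2 s" "monicize f = of_word [p1, p2] - emb s"
      "lead (monicize f) = [p1, p2]"
    using monicize_relations[OF assms(1)] by blast
  obtain q1 q2 t where g: "rewrite_to q1 q2 t" "monicize g = of_word [q1, q2] - emb t"
      "lead (monicize g) = [q1, q2]"
    using monicize_relations[OF assms(2)] by blast
  obtain u where u: "u \<in> Phi_star" and w: "w = [p1, p2]" "of_word w = subst_word lam (of_word [q1, q2]) u"
    and h: "h = monicize f - subst_word lam (monicize g) u"
    using assms(3) unfolding inclusion_composition_def f(3) g(3) by blast
  have "u \<in> Phi" and star: "deg_in {None} False u = 1"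
    using u by (auto simp: Phi_star_def)
  have "w \<in> Poly_Mapping.keys (subst_word lam (of_word [q1, q2]) u)"
    by (simp flip: w(2))
  \<comment> \<open>Both leading words have two letters and \<open>u\<close> has one star, so the
    equation reads 2 + 1 = deg u + 2, where the star counts as a letter.\<close>
  from deg_in_subst(2)[OF this] have "deg_in UNIV False u = 1"
    using star rewrite_to_primes(4)[OF f(1)] rewrite_to_primes(4)[OF g(1)] w(1) by simp
  then have "length u = 1"
    using Phi_length_le[OF \<open>u \<in> Phi\<close>] Phi_not_Nil[OF \<open>u \<in> Phi\<close>]
    by (metis One_nat_def le_Suc_eq le_zero_eq length_0_conv)
  then obtain p where p: "u = [p]"
    by (auto simp: length_Suc_conv)
  \<comment> \<open>A factor \<open>PP z\<close> would make every word of the substitution a single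
    prime, but \<open>w\<close> has two.\<close>
  have "p = Gen None"
  proof (cases p)
    case (Gen y)
    then show ?thesis using star p by (auto split: if_splits)
  next
    case (PP z)
    then have "Poly_Mapping.keys (of_word w :: ('i, 'k) rb) \<subseteq> range (\<lambda>v. [PP v])"
      unfolding w(2) p by (auto simp: keys_rb_P)
    then show ?thesis by (auto simp: w(1))
  qed
  then have "h = monicize f - monicize g" "[p1, p2] = [q1, q2]"
    using h p w by auto
  \<comment> \<open>With equal leading words the same rule applies to both, so the remainders agree
    by \<open>rewrite_to_unique\<close>.\<close>
  then have "h = 0"
    using f g rewrite_to_unique by auto
  then show ?thesis
    by (auto intro: trivial_modI rb.span_zero)
qed

end

theorem theorem4p5:
  fixes scale :: "'k::field_char_0 \<Rightarrow> 't::ab_group_add \<Rightarrow> 't"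
    and prec succ circ :: "'t \<Rightarrow> 't \<Rightarrow> 't"
    and x :: "'i::wellorder \<Rightarrow> 't"
    and lam :: 'k
  assumes "dendriform_trialgebra scale prec succ circ"
    and "indexed_basis scale x"
    and "lam \<noteq> 0"
  shows "compositions_trivial lam (trialgebra_relations scale prec succ circ x lam)"
proof -
  interpret based_trialgebra scale prec succ circ x lam
    using assms by (simp add: based_trialgebra_def based_trialgebra_axioms_def)
  show ?thesis
    unfolding compositions_trivial_def using intersection_trivial inclusion_trivial by blast
qed

end
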